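(* Let $\Sigma$ be a complete separable metric space, $\mu$ a Borel probability measure on $\Sigma$, $\ell:\Sigma\to[0,\infty)$ a bounded continuous function, and $R\in[0,2]$. Every $\nu\in\mathcal{M}_1(\Sigma)$, with $\xi=\nu-\mu$, satisfies $$\int_\Sigma\ell\,d\nu\le\Big\{\sup_{x\in\Sigma}\ell(x)-\inf_{x\in\Sigma}\ell(x)\Big\}\frac{\|\xi\|_{TV}}{2}+\int_\Sigma\ell\,d\mu .$$ Let $x^0\in\Sigma^0=\{x\in\Sigma:\ell(x)=\sup_{y\in\Sigma}\ell(y)\}$ and $x_0\in\Sigma_0=\{x\in\Sigma:\ell(x)=\inf_{y\in\Sigma}\ell(y)\}$. The upper bound is achieved by the signed measure $\xi^*\in\widetilde{\mathbb B}_R(\mu)$ given by $$\xi^*=\nu^*-\mu=\frac{R}{2}\left(\delta_{x^0}-\delta_{x_0}\right),$$ which has total variation $\|\xi^*\|_{TV}=R$ and satisfies $\int_\Sigma\ell\,d\xi^*=\frac R2\{\sup_{x\in\Sigma}\ell(x)-\inf_{x\in\Sigma}\ell(x)\}$. Hence, taking this $\nu^*$ as the maximizing distribution, $$D^+(R)=\int_\Sigma\ell\,d\nu^*=\frac{R}{2}\Big\{\sup_{x\in\Sigma}\ell(x)-\inf_{x\in\Sigma}\ell(x)\Big\}+\int_\Sigma\ell\,d\mu,$$ where $\nu^*$ satisfies the constraint $\|\nu^*-\mu\|_{TV}=R$, is normalized, $\nu^*(\Sigma)=1$, and satisfies $0\le\nu^*(A)\le1$ for every Borel set $A\subseteq\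Sigma$.
   Context: $\mathcal{M}_1(\Sigma)$ is the set of Borel probability measures on $\Sigma$, and $\delta_y$ is the Dirac measure at $y$. The total variation distance is $\|\alpha-\beta\|_{TV}=\sup_{P}\sum_{F\in P}|\alpha(F)-\beta(F)|$, the supremum being over all finite measurable partitions $P$ of $\Sigma$ (so it takes values in $[0,2]$ on probability measures); for a finite signed measure $\eta$ with Jordan decomposition $\eta=\eta^+-\eta^-$, $\|\eta\|_{TV}=\eta^+(\Sigma)+\eta^-(\Sigma)$. $\widetilde{\mathbb B}_R(\mu)$ is the set of finite signed measures $\xi$ on $\Sigma$ with $\xi(\Sigma)=0$, $\xi=\nu-\mu$ for some $\nu\in\mathcal{M}_1(\Sigma)$, and $\|\xi\|_{TV}\le R$. The extremum problem is $D^+(R)=\sup\big\{\int_\Sigma\ell\,d\nu:\ \nu\in\mathcal{M}_1(\Sigma),\ \|\nu-\mu\|_{TV}\le R\big\}$.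
   Formalization: ξ*∈B̃_R(μ), 0≤ν*(A)≤1 and the D⁺(R) formula are claimed only if ν*({x_0})≥0 (for x^0≠x_0: μ({x_0})≥R/2), since ν* may otherwise be negative; ‖ξ*‖=‖ν*−μ‖=R is claimed only if x^0≠x_0 or R=0. *)

theory Defs
  imports "HOL-Probability.Probability"
begin

definition borel_probs :: "'a::topological_space measure set" where
  "borel_probs = {\<nu>. prob_space \<nu> \<and> sets \<nu> = sets borel}"

(* Finite signed Borel measures are real-valued set functions. They are normalized to 0 outside the
   Borel sets, as measure is, so that equality of set functions is equality of signed measures. *)
definition finite_signed_measure :: "('a::topological_space set \<Rightarrow> real) \<Rightarrow> bool" where
  "finite_signed_measure \<eta> \<longleftrightarrow>
     \<eta> {} = 0 \<and>
     (\<forall>A. A \<notin> sets borel \<longrightarrow> \<eta> A = 0) \<and>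
     (\<forall>A::nat \<Rightarrow> 'a set. range A \<subseteq> sets borel \<longrightarrow> disjoint_family A \<longrightarrow>
        (\<lambda>i. \<eta> (A i)) sums \<eta> (\<Union>i. A i))"

definition jordan_decomposition ::
  "('a::topological_space set \<Rightarrow> real) \<Rightarrow> 'a measure \<Rightarrow> 'a measure \<Rightarrow> bool" where
  "jordan_decomposition \<eta> P N \<longleftrightarrow>
     finite_measure P \<and> sets P = sets borel \<and>
     finite_measure N \<and> sets N = sets borel \<and>
     (\<exists>H\<in>sets borel. measure P (- H) = 0 \<and> measure N H = 0) \<and>
     (\<forall>A\<in>sets borel. \<eta> A = measure P A - measure N A)"

definition tv_norm :: "('a::topological_space set \<Rightarrow> real) \<Rightarrow> real" where
  "tv_norm \<eta> = (THE v. \<exists>P N. jordan_decomposition \<eta> P N \<and> v = measure P UNIV + measure N UNIV)"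

definition signed_integral ::
  "('a::topological_space set \<Rightarrow> real) \<Rightarrow> ('a \<Rightarrow> real) \<Rightarrow> real" where
  "signed_integral \<eta> f =
     (THE v. \<exists>P N. jordan_decomposition \<eta> P N \<and> v = (\<integral>x. f x \<partial>P) - (\<integral>x. f x \<partial>N))"

(* The partition sup takes set functions, so that it also applies to signed arguments;
   the real-valued SUP is meaningful because finite signed measures have bounded variation. *)
definition tv_dist ::
  "('a::topological_space set \<Rightarrow> real) \<Rightarrow> ('a set \<Rightarrow> real) \<Rightarrow> real" where
  "tv_dist \<alpha> \<beta> =
     (SUP P\<in>{P. finite P \<and> partition_on UNIV P \<and> P \<subseteq> sets borel}. \<Sum>F\<in>P. \<bar>\<alpha> F - \<beta> F\<bar>)"

definition signed_diff ::
  "'a::topological_space measure \<Rightarrow> 'a measure \<Rightarrow> 'a set \<Rightarrow> real" where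
  "signed_diff \<nu> \<mu> = (\<lambda>A. measure \<nu> A - measure \<mu> A)"

definition signed_tv_ball ::
  "real \<Rightarrow> 'a::topological_space measure \<Rightarrow> ('a set \<Rightarrow> real) set" where
  "signed_tv_ball R \<mu> =
     {\<xi>. finite_signed_measure \<xi> \<and> \<xi> UNIV = 0 \<and>
         (\<exists>\<nu>\<in>borel_probs. \<xi> = signed_diff \<nu> \<mu>) \<and> tv_norm \<xi> \<le> R}"

definition D_plus :: "('a::topological_space \<Rightarrow> real) \<Rightarrow> 'a measure \<Rightarrow> real \<Rightarrow> real" where
  "D_plus l \<mu> R =
     Sup {\<integral>x. l x \<partial>\<nu> | \<nu>. \<nu> \<in> borel_probs \<and> tv_dist (measure \<nu>) (measure \<mu>) \<le> R}"

definition argmax_set :: "('a \<Rightarrow> real) \<Rightarrow> 'a set" where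
  "argmax_set l = {x. l x = (SUP y. l y)}"

definition argmin_set :: "('a \<Rightarrow> real) \<Rightarrow> 'a set" where
  "argmin_set l = {x. l x = (INF y. l y)}"

(* First point: a maximizer (mass added); second point: a minimizer (mass removed). *)
definition xi_star :: "real \<Rightarrow> 'a::topological_space \<Rightarrow> 'a \<Rightarrow> 'a set \<Rightarrow> real" where
  "xi_star R xmax xmin =
     (\<lambda>A. R / 2 * (measure (return borel xmax) A - measure (return borel xmin) A))"

(* In general only a signed measure: it is nonnegative iff its value at {xmin} is, i.e. (when
   xmax and xmin differ) iff the original measure has an atom of mass at least R/2 at xmin. *)
definition nu_star ::
  "'a::topological_space measure \<Rightarrow> real \<Rightarrow> 'a \<Rightarrow> 'a \<Rightarrow> 'a set \<Rightarrow> real" where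
  "nu_star \<mu> R xmax xmin = (\<lambda>A. measure \<mu> A + xi_star R xmax xmin A)"

end

theory Submission
  imports Defs
begin

text \<open>
  If \<open>\<nu> - \<mu> = P - N\<close> is the Jordan decomposition, then \<open>P\<close> and \<open>N\<close> have the same mass, half the
  total variation. Bounding \<open>l\<close> by its supremum on \<open>P\<close> and by its infimum on \<open>N\<close> gives the
  inequality, and equality holds when \<open>P\<close> sits on a maximizer and \<open>N\<close> on a minimizer.
\<close>

text \<open>\<open>tv_norm\<close> and \<open>signed_integral\<close> are definite descriptions over
  Jordan decompositions, so nothing can be computed before existence and uniqueness are known.
  Identities between signed measures are handled by moving negative terms to the other side, which
  yields equalities of genuine finite measures; sums of measures serve this purpose. The real
  obstacle is positivity: adding \<open>R / 2\<close> at a maximizer is harmless, but removing it at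
  a minimizer may exceed the mass that is there. Then \<open>nu_star\<close> is no measure and does
  not compete in \<open>D_plus\<close>. Hence its integral and its distance from
  \<open>\<mu>\<close> are computed for the signed set function, while attainment is claimed only
  when its value at \<open>{xmin}\<close> is nonnegative, a condition at one point that decides the
  sign on all Borel sets.\<close>

section \<open>Sums and multiples of measures\<close>

definition add_measure :: "'a measure \<Rightarrow> 'a measure \<Rightarrow> 'a measure" where
  "add_measure M N = measure_of (space M) (sets M) (\<lambda>A. emeasure M A + emeasure N A)"

lemma sets_add_measure [simp, measurable_cong]: "sets (add_measure M N) = sets M"
  by (simp add: add_measure_def)

lemma space_add_measure [simp]: "space (add_measure M N) = space M"
  by (simp add: add_measure_def)

lemma emeasure_add_measure:
  assumes "sets N = sets M" "A \<in> sets M"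
  shows "emeasure (add_measure M N) A = emeasure M A + emeasure N A"
  unfolding add_measure_def
proof (rule emeasure_measure_of_sigma)
  show "countably_additive (sets M) (\<lambda>A. emeasure M A + emeasure N A)"
    by (rule countably_additiveI) (simp add: assms suminf_add[symmetric] suminf_emeasure)
qed (auto simp: assms positive_def sets.sigma_algebra_axioms)

lemma nn_integral_add_measure:
  assumes f: "f \<in> borel_measurable M" and sets: "sets N = sets M"
  shows "nn_integral (add_measure M N) f = nn_integral M f + nn_integral N f"
  using f
proof induction
  case (cong f g)
  then show ?case
    by (metis nn_integral_cong sets_eq_imp_space_eq[OF sets] space_add_measure)
next
  case (set A)
  then show ?case
    using sets by (simp add: emeasure_add_measure)
next
  case (mult u c)
  then show ?case
    using sets by (simp add: nn_integral_cmult distrib_left measurable_cong_sets[OF sets refl]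
      measurable_cong_sets[OF sets_add_measure refl])
next
  case (add u v)
  then show ?case
    using sets by (simp add: nn_integral_add ac_simps measurable_cong_sets[OF sets refl]
      measurable_cong_sets[OF sets_add_measure refl])
next
  case (seq U)
  have m: "U i \<in> borel_measurable N" "U i \<in> borel_measurable (add_measure M N)" for i
    using seq.hyps(1) by (simp_all add: measurable_cong_sets[OF sets refl]
      measurable_cong_sets[OF sets_add_measure refl])
  \<comment> \<open>Both sequences of integrals increase; this is what lets
    \<open>ennreal_SUP_add\<close> split the supremum of the sums.\<close>
  have mono: "incseq (\<lambda>i. nn_integral K (U i))" for K
    using \<open>incseq U\<close> by (intro incseq_SucI nn_integral_mono) (simp add: incseq_Suc_iff le_fun_def)
  have SUP: "nn_integral K (SUP i. U i) = (SUP i. nn_integral K (U i))"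
    if "\<And>i. U i \<in> borel_measurable K" for K
    using nn_integral_monotone_convergence_SUP[OF \<open>incseq U\<close>, of K] that
    by (simp add: SUP_apply[abs_def])
  then show ?case
    using seq.IH by (simp only: SUP m seq.hyps(1) ennreal_SUP_add[OF mono mono])
qed

lemma finite_measure_add_measure:
  assumes "finite_measure M" "finite_measure N" "sets N = sets M"
  shows "finite_measure (add_measure M N)"
proof -
  interpret M: finite_measure M by fact
  interpret N: finite_measure N by fact
  show ?thesis
    by (rule finite_measureI)
      (simp add: emeasure_add_measure assms M.emeasure_eq_measure N.emeasure_eq_measure)
qed

lemma measure_add_measure:
  assumes "finite_measure M" "finite_measure N" "sets N = sets M"
  shows "measure (add_measure M N) A = measure M A + measure N A"
proof (cases "A \<in> sets M")
  case True
  interpret M: finite_measure M by fact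
  interpret N: finite_measure N by fact
  show ?thesis
    using True by (simp add: measure_def[of "add_measure M N"] emeasure_add_measure assms enn2real_plus
      M.emeasure_eq_measure N.emeasure_eq_measure)
next
  case False
  then show ?thesis by (simp add: measure_notin_sets assms)
qed

text \<open>The real integral is the difference of the nonnegative integrals of \<open>f\<close> and
  \<open>- f\<close>, each additive in the measure. Integrability keeps them finite, so that
  \<open>enn2real\<close> respects the sums.\<close>

lemma integral_add_measure:
  fixes f :: "'a \<Rightarrow> real"
  assumes f: "integrable M f" "integrable N f" and sets: "sets N = sets M"
  shows "(\<integral>x. f x \<partial>add_measure M N) = (\<integral>x. f x \<partial>M) + (\<integral>x. f x \<partial>N)"
proof -
  have [measurable]: "f \<in> borel_measurable M" using f by simp
  have nn: "(\<integral>\<^sup>+x. ennreal (g x) \<partial>add_measure M N) = (\<integral>\<^sup>+x. ennreal (g x) \<partial>M) + (\<integral>\<^sup>+x. ennreal (g x) \<partial>N)"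
    if "g \<in> borel_measurable M" for g
    using that by (intro nn_integral_add_measure sets) simp
  have fin: "(\<integral>\<^sup>+x. ennreal (f x) \<partial>K) < top" "(\<integral>\<^sup>+x. ennreal (- f x) \<partial>K) < top"
    if "integrable K f" for K
    using that by (auto simp: real_integrable_def less_top)
  have "integrable (add_measure M N) f"
    using fin[OF f(1)] fin[OF f(2)]
    by (auto simp: real_integrable_def nn less_top measurable_cong_sets[OF sets_add_measure refl])
  then show ?thesis
    using fin[OF f(1)] fin[OF f(2)]
    by (simp add: real_lebesgue_integral_def f nn enn2real_plus)
qed

lemma finite_measure_scale_measure:
  assumes "finite_measure M"
  shows "finite_measure (scale_measure (ennreal r) M)"
proof -
  interpret finite_measure M by fact
  show ?thesis
    by (rule finite_measureI) (simp add: space_scale_measure emeasure_eq_measure ennreal_mult_eq_top_iff)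
qed

text \<open>Scaling is the density with a constant function, which reduces the claim to
  \<open>integral_density\<close>.\<close>

lemma integral_scale_measure:
  fixes f :: "'a \<Rightarrow> real"
  assumes r: "0 \<le> r" and f: "f \<in> borel_measurable M"
  shows "(\<integral>x. f x \<partial>scale_measure (ennreal r) M) = r * (\<integral>x. f x \<partial>M)"
proof -
  have "scale_measure (ennreal r) M = density M (\<lambda>_. ennreal r)"
  proof (rule measure_eqI)
    fix A assume "A \<in> sets (scale_measure (ennreal r) M)"
    then have "A \<in> sets M" by simp
    then show "emeasure (scale_measure (ennreal r) M) A = emeasure (density M (\<lambda>_. ennreal r)) A"
      unfolding emeasure_scale_measure by (rule emeasure_density_const[symmetric])
  qed simp
  also have "(\<integral>x. f x \<partial>density M (\<lambda>_. ennreal r)) = (\<integral>x. r *\<^sub>R f x \<partial>M)"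
    by (rule integral_density) (auto simp: r f)
  finally show ?thesis by simp
qed

section \<open>Existence and uniqueness of the Jordan decomposition\<close>

lemma measure_Int_Compl_split:
  assumes "finite_measure K" "sets K = sets borel" "A \<in> sets borel" "B \<in> sets borel"
  shows "measure K A = measure K (A \<inter> B) + measure K (A \<inter> - B)"
proof -
  have "(A \<inter> B) \<union> (A \<inter> - B) = A" by blast
  then show ?thesis
    using finite_measure.finite_measure_Union[of K "A \<inter> B" "A \<inter> - B"] assms by force
qed

text \<open>One half of a Hahn decomposition turned into a measure. Restricting by the density
  \<open>indicator Z\<close> keeps all Borel sets measurable and extends the domination from subsets
  of \<open>Z\<close> to every Borel set, as subtraction by \<open>diff_measure\<close>
  demands.\<close>

lemma restricted_diff_measure_exists:
  fixes K L :: "'a::topological_space measure"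
  assumes K: "finite_measure K" "sets K = sets borel" and L: "finite_measure L" "sets L = sets borel"
    and Z: "Z \<in> sets borel"
    and le: "\<forall>X\<in>sets borel. X \<subseteq> Z \<longrightarrow> emeasure L X \<le> emeasure K X"
  shows "\<exists>D. finite_measure D \<and> sets D = sets borel \<and>
    (\<forall>A\<in>sets borel. measure D A = measure K (A \<inter> Z) - measure L (A \<inter> Z))"
proof -
  interpret K: finite_measure K by fact
  interpret L: finite_measure L by fact
  have dens: "emeasure (density J (indicator Z)) A = emeasure J (A \<inter> Z)"
    if J: "sets J = sets borel" and A: "A \<in> sets borel" for J :: "'a measure" and A
  proof -
    have m: "A \<in> sets J" "Z \<in> sets J" using A Z by (simp_all only: J)
    have "emeasure (density J (indicator Z)) A = (\<integral>\<^sup>+x. indicator Z x * indicator A x \<partial>J)"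
      using m by (intro emeasure_density) auto
    also have "\<dots> = (\<integral>\<^sup>+x. indicator (A \<inter> Z) x \<partial>J)"
      by (intro nn_integral_cong) (simp split: split_indicator)
    also have "\<dots> = emeasure J (A \<inter> Z)"
      using m by (intro nn_integral_indicator) auto
    finally show ?thesis .
  qed
  have fin: "finite_measure (density J (indicator Z))"
    if J: "finite_measure J" "sets J = sets borel" for J :: "'a measure"
  proof (rule finite_measureI)
    have "space (density J (indicator Z)) \<in> sets borel"
      using sets.top[of J] J(2) by simp
    then show "emeasure (density J (indicator Z)) (space (density J (indicator Z))) \<noteq> \<infinity>"
      using finite_measure.emeasure_finite[OF J(1)] by (simp only: dens[OF J(2)]) simp
  qed
  define D where "D = diff_measure (density K (indicator Z)) (density L (indicator Z))"
  have em: "emeasure D A = ennreal (measure K (A \<inter> Z) - measure L (A \<inter> Z))"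
    and pos: "0 \<le> measure K (A \<inter> Z) - measure L (A \<inter> Z)" if A: "A \<in> sets borel" for A
  proof -
    have le': "emeasure L (X \<inter> Z) \<le> emeasure K (X \<inter> Z)" if "X \<in> sets borel" for X
      using that Z by (intro le[rule_format]) auto
    have "emeasure D A = emeasure (density K (indicator Z)) A - emeasure (density L (indicator Z)) A"
      unfolding D_def
    proof (rule emeasure_diff_measure[OF fin[OF K] fin[OF L]])
      show "sets (density K (indicator Z)) = sets (density L (indicator Z))"
        by (simp only: sets_density K(2) L(2))
      show "A \<in> sets (density K (indicator Z))"
        using A by (simp only: sets_density K(2))
      fix X assume "X \<in> sets (density K (indicator Z))"
      then have "X \<in> sets borel" by (simp only: sets_density K(2))
      then show "emeasure (density L (indicator Z)) X \<le> emeasure (density K (indicator Z)) X"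
        by (simp only: dens K(2) L(2) le')
    qed
    also have "\<dots> = emeasure K (A \<inter> Z) - emeasure L (A \<inter> Z)"
      by (simp only: dens[OF K(2) A] dens[OF L(2) A])
    finally show "emeasure D A = ennreal (measure K (A \<inter> Z) - measure L (A \<inter> Z))"
      by (simp add: K.emeasure_eq_measure L.emeasure_eq_measure ennreal_minus)
    show "0 \<le> measure K (A \<inter> Z) - measure L (A \<inter> Z)"
      using le'[OF A] by (simp add: K.emeasure_eq_measure L.emeasure_eq_measure)
  qed
  show ?thesis
  proof (intro exI[of _ D] conjI ballI)
    show sD: "sets D = sets borel" by (simp only: D_def sets_diff_measure sets_density K(2))
    have "space D \<in> sets borel" using sets.top[of D] by (simp only: sD)
    from em[OF this] show "finite_measure D"
      by (intro finite_measureI) simp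
    show "measure D A = measure K (A \<inter> Z) - measure L (A \<inter> Z)" if "A \<in> sets borel" for A
      using em[OF that] pos[OF that] by (rule measure_eq_emeasure_eq_ennreal[rotated])
  qed
qed

text \<open>With a Hahn set \<open>Y\<close>, the positive part is \<open>M - N\<close> cut down to
  \<open>Y\<close> and the negative part is \<open>N - M\<close> cut down to its complement.\<close>

lemma jordan_decomposition_diff_exists:
  fixes M N :: "'a::topological_space measure"
  assumes M: "finite_measure M" "sets M = sets borel" and N: "finite_measure N" "sets N = sets borel"
  obtains P Q where "jordan_decomposition (\<lambda>A. measure M A - measure N A) P Q"
proof -
  have "sets N = sets M" by (simp only: M(2) N(2))
  from finite_unsigned_Hahn_decomposition[OF M(1) N(1) this, unfolded M(2)]
  obtain Y where Y: "Y \<in> sets borel"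
    and pos: "\<forall>X\<in>sets borel. X \<subseteq> Y \<longrightarrow> emeasure N X \<le> emeasure M X"
    and neg: "\<forall>X\<in>sets borel. X \<inter> Y = {} \<longrightarrow> emeasure M X \<le> emeasure N X"
    by (elim bexE conjE)
  have Y': "- Y \<in> sets borel" using Y by auto
  have neg': "\<forall>X\<in>sets borel. X \<subseteq> - Y \<longrightarrow> emeasure M X \<le> emeasure N X"
    using neg by (simp only: disjoint_eq_subset_Compl)
  obtain P where P: "finite_measure P" "sets P = sets borel"
    "\<forall>A\<in>sets borel. measure P A = measure M (A \<inter> Y) - measure N (A \<inter> Y)"
    using restricted_diff_measure_exists[OF M N Y pos] by (elim exE conjE)
  obtain Q where Q: "finite_measure Q" "sets Q = sets borel"
    "\<forall>A\<in>sets borel. measure Q A = measure N (A \<inter> - Y) - measure M (A \<inter> - Y)"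
    using restricted_diff_measure_exists[OF N M Y' neg'] by (elim exE conjE)
  have "measure P (- Y) = 0" "measure Q Y = 0"
    by (simp_all add: bspec[OF P(3) Y'] bspec[OF Q(3) Y])
  moreover have "measure M A - measure N A = measure P A - measure Q A" if A: "A \<in> sets borel" for A
    using measure_Int_Compl_split[OF M A Y] measure_Int_Compl_split[OF N A Y] bspec[OF P(3) A] bspec[OF Q(3) A]
    by linarith
  ultimately have "jordan_decomposition (\<lambda>A. measure M A - measure N A) P Q"
    unfolding jordan_decomposition_def using P(1,2) Q(1,2) Y by (intro conjI bexI[of _ Y] ballI)
  then show ?thesis by (rule that)
qed

lemma jordan_decompositionD:
  assumes J: "jordan_decomposition \<eta> P N"
  shows "finite_measure P" "finite_measure N" "sets P = sets borel" "sets N = sets borel"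
    "space P = UNIV" "space N = UNIV"
    "\<And>A. A \<in> sets borel \<Longrightarrow> \<eta> A = measure P A - measure N A"
proof -
  note J' = J[unfolded jordan_decomposition_def]
  show "finite_measure P" using J' by (elim conjE)
  show "finite_measure N" using J' by (elim conjE)
  show setsP: "sets P = sets borel" using J' by (elim conjE)
  show setsN: "sets N = sets borel" using J' by (elim conjE)
  show "space P = UNIV" "space N = UNIV"
    using setsP[THEN sets_eq_imp_space_eq] setsN[THEN sets_eq_imp_space_eq] by simp_all
  show "\<eta> A = measure P A - measure N A" if "A \<in> sets borel" for A
    using J' that by (elim conjE bspec)
qed

text \<open>The complement of a Hahn set serves for the negated measure. This carries uniqueness of
  the positive part over to the negative part.\<close>

lemma jordan_decomposition_swap:
  assumes J: "jordan_decomposition \<eta> P N"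
  shows "jordan_decomposition (\<lambda>A. - \<eta> A) N P"
proof -
  obtain H where H: "H \<in> sets borel" "measure P (- H) = 0" "measure N H = 0"
    using J unfolding jordan_decomposition_def by (elim conjE bexE)
  have "- H \<in> sets borel" "measure N (- (- H)) = 0" using H by simp_all
  then have "\<exists>H\<in>sets borel. measure N (- H) = 0 \<and> measure P H = 0"
    using H(2) by (intro bexI[of _ "- H"] conjI)
  moreover have "- \<eta> A = measure N A - measure P A" if "A \<in> sets borel" for A
    using jordan_decompositionD(7)[OF J that] by linarith
  ultimately show ?thesis
    unfolding jordan_decomposition_def
    by (intro conjI ballI jordan_decompositionD[OF J])
qed

text \<open>Since \<open>P\<close> lives on \<open>H\<close> and \<open>N\<close> vanishes there,
  \<open>P A\<close> equals \<open>\<eta> (A \<inter> H)\<close>, which is at most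
  \<open>P' (A \<inter> H)\<close> and so at most \<open>P' A\<close>. Exchanging the two
  decompositions gives equality.\<close>

lemma jordan_decomposition_minimal:
  assumes J: "jordan_decomposition \<eta> P N" and J': "jordan_decomposition \<eta> P' N'"
    and A: "A \<in> sets borel"
  shows "measure P A \<le> measure P' A"
proof -
  note P = jordan_decompositionD[OF J] and P' = jordan_decompositionD[OF J']
  obtain H where H: "H \<in> sets borel" "measure P (- H) = 0" "measure N H = 0"
    using J unfolding jordan_decomposition_def by (elim conjE bexE)
  have AH: "A \<inter> H \<in> sets borel" using A H(1) by (rule sets.Int)
  have "measure P (A \<inter> - H) \<le> measure P (- H)"
    using H(1) P(3) by (intro finite_measure.finite_measure_mono P(1)) auto
  moreover have "measure N (A \<inter> H) \<le> measure N H"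
    using H(1) P(4) by (intro finite_measure.finite_measure_mono P(2)) auto
  moreover have "measure P' (A \<inter> H) \<le> measure P' A"
    using A P'(3) by (intro finite_measure.finite_measure_mono P'(1)) auto
  ultimately show ?thesis
    using measure_Int_Compl_split[OF P(1,3) A H(1)] P(7)[OF AH] P'(7)[OF AH] H(2,3)
      measure_nonneg[of N' "A \<inter> H"] measure_nonneg[of N "A \<inter> H"] by linarith
qed

lemma jordan_decomposition_unique_positive:
  assumes J: "jordan_decomposition \<eta> P N" and J': "jordan_decomposition \<eta> P' N'"
  shows "P = P'"
proof (rule measure_eqI)
  note P = jordan_decompositionD[OF J] and P' = jordan_decompositionD[OF J']
  show "sets P = sets P'" by (simp only: P(3) P'(3))
  fix A assume "A \<in> sets P"
  then have A: "A \<in> sets borel" by (simp only: P(3))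
  have "measure P A = measure P' A"
    by (rule antisym[OF jordan_decomposition_minimal[OF J J' A] jordan_decomposition_minimal[OF J' J A]])
  then show "emeasure P A = emeasure P' A"
    by (simp only: finite_measure.emeasure_eq_measure[OF P(1)] finite_measure.emeasure_eq_measure[OF P'(1)])
qed

lemma jordan_decomposition_unique:
  assumes "jordan_decomposition \<eta> P N" "jordan_decomposition \<eta> P' N'"
  shows "P = P'" "N = N'"
  by (rule jordan_decomposition_unique_positive[OF assms])
    (rule jordan_decomposition_unique_positive[OF assms[THEN jordan_decomposition_swap]])

text \<open>The abstract \<open>F\<close> covers the descriptions in \<open>tv_norm\<close> and
  \<open>signed_integral\<close> by one argument.\<close>

lemma the_jordan_decomposition_eq:
  assumes J: "jordan_decomposition \<eta> P N"
  shows "(THE v. \<exists>P N. jordan_decomposition \<eta> P N \<and> v = F P N) = F P N"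
proof (rule the_equality)
  show "\<exists>P' N'. jordan_decomposition \<eta> P' N' \<and> F P N = F P' N'"
    by (rule exI[of _ P], rule exI[of _ N]) (simp add: J)
  fix v assume "\<exists>P' N'. jordan_decomposition \<eta> P' N' \<and> v = F P' N'"
  then obtain P' N' where J': "jordan_decomposition \<eta> P' N'" and v: "v = F P' N'"
    by (elim exE conjE)
  show "v = F P N"
    unfolding v jordan_decomposition_unique[OF J J'] ..
qed

section \<open>Evaluating the norm and the integral of a signed measure\<close>

lemma tv_norm_eq:
  assumes "jordan_decomposition \<eta> P N"
  shows "tv_norm \<eta> = measure P UNIV + measure N UNIV"
  unfolding tv_norm_def by (rule the_jordan_decomposition_eq[OF assms])

lemma signed_integral_eq:
  assumes "jordan_decomposition \<eta> P N"
  shows "signed_integral \<eta> f = (\<integral>x. f x \<partial>P) - (\<integral>x. f x \<partial>N)"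
  unfolding signed_integral_def by (rule the_jordan_decomposition_eq[OF assms])

lemma integrable_bounded_borel:
  fixes f :: "'a::topological_space \<Rightarrow> real"
  assumes M: "finite_measure M" "sets M = sets borel"
    and f: "f \<in> borel_measurable borel" "bounded (range f)"
  shows "integrable M f"
proof -
  obtain B where B: "\<forall>y\<in>range f. norm y \<le> B"
    using f(2) unfolding bounded_iff by (elim exE)
  have "AE x in M. norm (f x) \<le> B"
    by (intro AE_I2 B[rule_format] rangeI)
  moreover have "f \<in> borel_measurable M"
    unfolding measurable_cong_sets[OF M(2) refl] by (rule f(1))
  ultimately show ?thesis
    by (rule finite_measure.integrable_const_bound[OF M(1)])
qed

text \<open>The identity \<open>M - N = P - Q\<close> of set functions becomes the identity
  \<open>P + N = M + Q\<close> of measures, which can be integrated. All four integrals are finite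
  because \<open>f\<close> is bounded.\<close>

lemma jordan_decomposition_integral_diff:
  fixes f :: "'a::topological_space \<Rightarrow> real"
  assumes M: "finite_measure M" "sets M = sets borel" and N: "finite_measure N" "sets N = sets borel"
    and f: "f \<in> borel_measurable borel" "bounded (range f)"
    and J: "jordan_decomposition (\<lambda>A. measure M A - measure N A) P Q"
  shows "(\<integral>x. f x \<partial>P) - (\<integral>x. f x \<partial>Q) = (\<integral>x. f x \<partial>M) - (\<integral>x. f x \<partial>N)"
proof -
  note P = jordan_decompositionD[OF J]
  have eq: "sets N = sets P" "sets Q = sets M"
    by (simp_all only: M(2) N(2) P(3,4))
  have fin: "finite_measure (add_measure P N)" "finite_measure (add_measure M Q)"
    by (rule finite_measure_add_measure M N P eq)+
  have "add_measure P N = add_measure M Q"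
  proof (rule measure_eqI)
    show "sets (add_measure P N) = sets (add_measure M Q)"
      by (simp only: sets_add_measure M(2) P(3))
    fix A assume "A \<in> sets (add_measure P N)"
    then have A: "A \<in> sets borel" by (simp only: sets_add_measure P(3))
    have "measure (add_measure P N) A = measure (add_measure M Q) A"
      unfolding measure_add_measure[OF P(1) N(1) eq(1)] measure_add_measure[OF M(1) P(2) eq(2)]
      using P(7)[OF A] by linarith
    then show "emeasure (add_measure P N) A = emeasure (add_measure M Q) A"
      by (simp only: finite_measure.emeasure_eq_measure[OF fin(1)] finite_measure.emeasure_eq_measure[OF fin(2)])
  qed
  moreover have int: "integrable P f" "integrable Q f" "integrable M f" "integrable N f"
    by (rule integrable_bounded_borel M N P f)+
  ultimately have "(\<integral>x. f x \<partial>P) + (\<integral>x. f x \<partial>N) = (\<integral>x. f x \<partial>M) + (\<integral>x. f x \<partial>Q)"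
    using integral_add_measure[OF int(1,4) eq(1)] integral_add_measure[OF int(3,2) eq(2)]
    by (simp only:)
  then show ?thesis by linarith
qed

lemma signed_integral_diff:
  fixes f :: "'a::topological_space \<Rightarrow> real"
  assumes M: "finite_measure M" "sets M = sets borel" and N: "finite_measure N" "sets N = sets borel"
    and f: "f \<in> borel_measurable borel" "bounded (range f)"
  \<comment> \<open>Any representation as a difference of finite measures suffices for computing the
    integral; no Hahn set has to be exhibited.\<close>
  shows "signed_integral (\<lambda>A. measure M A - measure N A) f = (\<integral>x. f x \<partial>M) - (\<integral>x. f x \<partial>N)"
proof -
  obtain P Q where J: "jordan_decomposition (\<lambda>A. measure M A - measure N A) P Q"
    by (rule jordan_decomposition_diff_exists[OF M N])
  show ?thesis
    unfolding signed_integral_eq[OF J] by (rule jordan_decomposition_integral_diff[OF M N f J])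
qed

lemma finite_signed_measure_diff:
  fixes M N :: "'a::topological_space measure"
  assumes M: "finite_measure M" "sets M = sets borel" and N: "finite_measure N" "sets N = sets borel"
  shows "finite_signed_measure (\<lambda>A. measure M A - measure N A)"
  unfolding finite_signed_measure_def
proof (intro conjI allI impI)
  fix A :: "'a set" assume "A \<notin> sets borel"
  then have "A \<notin> sets M" "A \<notin> sets N" by (simp_all only: M(2) N(2) not_False_eq_True)
  then show "measure M A - measure N A = 0" by (simp add: measure_notin_sets)
next
  fix A :: "nat \<Rightarrow> 'a set" assume A: "range A \<subseteq> sets borel" "disjoint_family A"
  show "(\<lambda>i. measure M (A i) - measure N (A i)) sums (measure M (\<Union>i. A i) - measure N (\<Union>i. A i))"
    by (intro sums_diff finite_measure.finite_measure_UNION M N A(2)) (simp_all only: M(2) N(2) A(1))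
qed simp

section \<open>Total variation through partitions\<close>

text \<open>The triangle inequality on each cell bounds every partition sum by the total mass of
  \<open>P\<close> and \<open>N\<close>; splitting the space into a Hahn set and its complement
  attains this bound.\<close>

lemma tv_dist_eq:
  fixes \<alpha> \<beta> :: "'a::topological_space set \<Rightarrow> real"
  assumes J: "jordan_decomposition (\<lambda>A. \<alpha> A - \<beta> A) P N"
  shows "tv_dist \<alpha> \<beta> = measure P UNIV + measure N UNIV"
  unfolding tv_dist_def
proof (rule cSup_eq_maximum)
  note P = jordan_decompositionD[OF J]
  interpret P: finite_measure P by (rule P)
  interpret N: finite_measure N by (rule P)
  let ?S = "(\<lambda>\<P>. \<Sum>F\<in>\<P>. \<bar>\<alpha> F - \<beta> F\<bar>) ` {\<P>. finite \<P> \<and> partition_on UNIV \<P> \<and> \<P> \<subseteq> sets borel}"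
  obtain H where H: "H \<in> sets borel" "measure P (- H) = 0" "measure N H = 0"
    using J by (auto simp: jordan_decomposition_def)
  show "measure P UNIV + measure N UNIV \<in> ?S"
  proof
    \<comment> \<open>A partition has no empty cell, but \<open>H\<close> or its complement may be
      empty. The discarded cell would contribute 0 to the sum.\<close>
    let ?\<P> = "{H, - H} - {{}}"
    show "?\<P> \<in> {\<P>. finite \<P> \<and> partition_on UNIV \<P> \<and> \<P> \<subseteq> sets borel}"
      using H by (auto simp: partition_on_def disjoint_def)
    have tot: "measure P UNIV = measure P H" "measure N UNIV = measure N (- H)"
      using measure_Int_Compl_split[OF P(1,3) _ H(1), of UNIV] measure_Int_Compl_split[OF P(2,4) _ H(1), of UNIV] H(2,3)
      by simp_all
    have "(\<Sum>F\<in>?\<P>. \<bar>\<alpha> F - \<beta> F\<bar>) = (\<Sum>F\<in>{H, - H}. \<bar>\<alpha> F - \<beta> F\<bar>)"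
      using P(7)[of "{}"] by (intro sum.mono_neutral_left) auto
    also have "\<dots> = \<bar>\<alpha> H - \<beta> H\<bar> + \<bar>\<alpha> (- H) - \<beta> (- H)\<bar>"
      by (subst sum.insert) auto
    also have "\<dots> = measure P UNIV + measure N UNIV"
      using P(7)[OF H(1)] P(7)[of "- H"] H tot by simp
    finally show "measure P UNIV + measure N UNIV = (\<Sum>F\<in>?\<P>. \<bar>\<alpha> F - \<beta> F\<bar>)" ..
  qed
  fix v assume "v \<in> ?S"
  then obtain \<P> where \<P>: "finite \<P>" "partition_on UNIV \<P>" "\<P> \<subseteq> sets borel"
    and v: "v = (\<Sum>F\<in>\<P>. \<bar>\<alpha> F - \<beta> F\<bar>)" by auto
  have "v \<le> (\<Sum>F\<in>\<P>. measure P F + measure N F)"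
    unfolding v
  proof (rule sum_mono)
    fix F assume "F \<in> \<P>"
    then have "F \<in> sets borel" using \<P>(3) by auto
    from P(7)[OF this] show "\<bar>\<alpha> F - \<beta> F\<bar> \<le> measure P F + measure N F"
      using measure_nonneg[of P F] measure_nonneg[of N F] by linarith
  qed
  also have "\<dots> = (\<Sum>F\<in>\<P>. measure P F) + (\<Sum>F\<in>\<P>. measure N F)"
    by (rule sum.distrib)
  also have "\<dots> = measure P UNIV + measure N UNIV"
  proof -
    have "disjoint_family_on id \<P>" "\<Union>\<P> = UNIV"
      using \<P>(2) by (auto simp: partition_on_def disjoint_def disjoint_family_on_def)
    then show ?thesis
      using P.finite_measure_finite_Union[of \<P> id] N.finite_measure_finite_Union[of \<P> id] \<P> P
      by simp
  qed
  finally show "v \<le> measure P UNIV + measure N UNIV" .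
qed

section \<open>The upper bound for probability measures\<close>

lemma borel_probsD:
  fixes \<nu> :: "'a::topological_space measure"
  assumes "\<nu> \<in> borel_probs"
  shows "prob_space \<nu>" "sets \<nu> = sets borel" "finite_measure \<nu>" "measure \<nu> UNIV = 1"
proof -
  show p: "prob_space \<nu>" and s: "sets \<nu> = sets borel"
    using assms by (simp_all add: borel_probs_def)
  show "finite_measure \<nu>" using p by (rule prob_space.finite_measure)
  have "space \<nu> = UNIV" using sets_eq_imp_space_eq[OF s] by simp
  then show "measure \<nu> UNIV = 1" using prob_space.prob_space[OF p] by simp
qed

text \<open>Links the constraint in \<open>D_plus\<close>, phrased by partitions, with the norm in
  the upper bound and in \<open>signed_tv_ball\<close>.\<close>

lemma tv_dist_eq_tv_norm:
  assumes \<nu>: "\<nu> \<in> borel_probs" and \<mu>: "\<mu> \<in> borel_probs"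
  shows "tv_dist (measure \<nu>) (measure \<mu>) = tv_norm (signed_diff \<nu> \<mu>)"
proof -
  obtain P N where J: "jordan_decomposition (\<lambda>A. measure \<nu> A - measure \<mu> A) P N"
    by (rule jordan_decomposition_diff_exists[OF borel_probsD(3,2)[OF \<nu>] borel_probsD(3,2)[OF \<mu>]])
  show ?thesis
    unfolding signed_diff_def tv_dist_eq[OF J] tv_norm_eq[OF J] ..
qed

lemma integral_le_oscillation_tv:
  fixes l :: "'a::topological_space \<Rightarrow> real"
  assumes \<nu>: "\<nu> \<in> borel_probs" and \<mu>: "\<mu> \<in> borel_probs"
    and l: "l \<in> borel_measurable borel" "bounded (range l)"
  shows "(\<integral>x. l x \<partial>\<nu>) \<le> ((SUP x. l x) - (INF x. l x)) * (tv_norm (signed_diff \<nu> \<mu>) / 2) + (\<integral>x. l x \<partial>\<mu>)"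
proof -
  note \<nu>' = borel_probsD(3,2)[OF \<nu>] and \<mu>' = borel_probsD(3,2)[OF \<mu>]
  obtain P N where J: "jordan_decomposition (\<lambda>A. measure \<nu> A - measure \<mu> A) P N"
    by (rule jordan_decomposition_diff_exists[OF \<nu>' \<mu>'])
  note P = jordan_decompositionD[OF J]
  let ?t = "tv_norm (signed_diff \<nu> \<mu>) / 2"
  \<comment> \<open>Both \<open>\<nu>\<close> and \<open>\<mu>\<close> have mass 1, so their
    difference has total mass 0.\<close>
  have "measure P UNIV = measure N UNIV"
    using P(7)[of UNIV] borel_probsD(4)[OF \<nu>] borel_probsD(4)[OF \<mu>] by simp
  then have mass: "measure P UNIV = ?t" "measure N UNIV = ?t"
    using tv_norm_eq[OF J] by (simp_all add: signed_diff_def)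
  have int: "integrable P l" "integrable N l"
    by (rule integrable_bounded_borel P l)+
  have "(\<integral>x. l x \<partial>P) \<le> (\<integral>x. (SUP x. l x) \<partial>P)"
    using l(2) by (intro integral_mono int finite_measure.integrable_const P cSUP_upper bounded_imp_bdd_above UNIV_I)
  moreover have "(\<integral>x. (INF x. l x) \<partial>N) \<le> (\<integral>x. l x \<partial>N)"
    using l(2) by (intro integral_mono int finite_measure.integrable_const P cINF_lower bounded_imp_bdd_below UNIV_I)
  moreover have "(\<integral>x. l x \<partial>P) - (\<integral>x. l x \<partial>N) = (\<integral>x. l x \<partial>\<nu>) - (\<integral>x. l x \<partial>\<mu>)"
    by (rule jordan_decomposition_integral_diff[OF \<nu>' \<mu>' l J])
  moreover have "(\<integral>x. (SUP x. l x) \<partial>P) = (SUP x. l x) * ?t"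
    by (simp only: lebesgue_integral_const P(5) mass real_scaleR_def mult.commute)
  moreover have "(\<integral>x. (INF x. l x) \<partial>N) = (INF x. l x) * ?t"
    by (simp only: lebesgue_integral_const P(6) mass real_scaleR_def mult.commute)
  ultimately show ?thesis unfolding left_diff_distrib by linarith
qed

section \<open>The extremal signed measure\<close>

text \<open>The sign of \<open>R\<close> matters because \<open>ennreal\<close> sends negative
  factors to 0.\<close>

lemma xi_star_eq_diff:
  assumes "0 \<le> R"
  shows "xi_star R x y = (\<lambda>A. measure (scale_measure (ennreal (R / 2)) (return borel x)) A
    - measure (scale_measure (ennreal (R / 2)) (return borel y)) A)"
  using assms by (auto simp: xi_star_def right_diff_distrib)

lemma finite_measure_scale_return:
  "finite_measure (scale_measure (ennreal r) (return borel x))"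
  by (intro finite_measure_scale_measure prob_space.finite_measure prob_space_return) simp

text \<open>The Hahn set is \<open>{x}\<close>, closed in a T1 space and hence Borel. For
  \<open>x = y\<close> and \<open>R > 0\<close> the two masses cancel, so these multiples are not
  mutually singular and the pair is no Jordan decomposition.\<close>

lemma jordan_decomposition_xi_star:
  fixes x y :: "'a::t1_space"
  assumes "0 \<le> R" "x \<noteq> y \<or> R = 0"
  shows "jordan_decomposition (xi_star R x y) (scale_measure (ennreal (R / 2)) (return borel x))
    (scale_measure (ennreal (R / 2)) (return borel y))"
proof -
  have "\<exists>H\<in>sets borel. measure (scale_measure (ennreal (R / 2)) (return borel x)) (- H) = 0 \<and>
      measure (scale_measure (ennreal (R / 2)) (return borel y)) H = 0"
    using assms by (intro bexI[of _ "{x}"]) (auto simp: measure_return)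
  then show ?thesis
    using assms by (simp add: jordan_decomposition_def finite_measure_scale_return xi_star_eq_diff)
qed

lemma tv_norm_xi_star:
  fixes x y :: "'a::t1_space"
  assumes "0 \<le> R" "x \<noteq> y \<or> R = 0"
  shows "tv_norm (xi_star R x y) = R"
  using assms by (simp add: tv_norm_eq[OF jordan_decomposition_xi_star] measure_return)

text \<open>Reduces coinciding points to \<open>R = 0\<close>, where the norm formula applies and
  gives 0.\<close>

lemma xi_star_refl: "xi_star R x x = xi_star 0 x x"
  by (simp add: xi_star_def)

section \<open>The extremum problem\<close>

text \<open>Two conditions guard the conclusions. The norm equals \<open>R\<close> if the points
  differ or \<open>R = 0\<close>; coinciding points, as for constant \<open>l\<close>, make
  \<open>xi_star\<close> vanish. Attainment and the value of \<open>D_plus\<close> need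
  \<open>nu_star\<close> to be a probability measure, which nonnegativity at \<open>{xmin}\<close>
  ensures.\<close>

theorem mainTheorem4:
  fixes \<mu> :: "'a::polish_space measure" and l :: "'a \<Rightarrow> real" and R :: real
  assumes "\<mu> \<in> borel_probs"
    and "continuous_on UNIV l" and "bounded (range l)" and "\<And>x. 0 \<le> l x"
    and "0 \<le> R" and "R \<le> 2"
  shows
    "(\<forall>\<nu>\<in>borel_probs.
        (\<integral>x. l x \<partial>\<nu>) \<le> ((SUP x. l x) - (INF x. l x)) * (tv_norm (signed_diff \<nu> \<mu>) / 2)
                       + (\<integral>x. l x \<partial>\<mu>)) \<and>
     (\<forall>xmax\<in>argmax_set l. \<forall>xmin\<in>argmin_set l.
        finite_signed_measure (xi_star R xmax xmin) \<and>
        xi_star R xmax xmin UNIV = 0 \<and>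
        signed_integral (xi_star R xmax xmin) l = R / 2 * ((SUP x. l x) - (INF x. l x)) \<and>
        signed_integral (nu_star \<mu> R xmax xmin) l
          = ((SUP x. l x) - (INF x. l x)) * (tv_norm (xi_star R xmax xmin) / 2)
            + (\<integral>x. l x \<partial>\<mu>) \<and>
        signed_integral (nu_star \<mu> R xmax xmin) l
          = R / 2 * ((SUP x. l x) - (INF x. l x)) + (\<integral>x. l x \<partial>\<mu>) \<and>
        nu_star \<mu> R xmax xmin UNIV = 1 \<and>
        (xmax \<noteq> xmin \<or> R = 0 \<longrightarrow>
           tv_norm (xi_star R xmax xmin) = R \<and>
           tv_dist (nu_star \<mu> R xmax xmin) (measure \<mu>) = R) \<and>
        (0 \<le> nu_star \<mu> R xmax xmin {xmin} \<longrightarrow>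
           xi_star R xmax xmin \<in> signed_tv_ball R \<mu> \<and>
           (\<forall>A\<in>sets borel. 0 \<le> nu_star \<mu> R xmax xmin A \<and> nu_star \<mu> R xmax xmin A \<le> 1) \<and>
           (\<exists>\<nu>\<in>borel_probs. measure \<nu> = nu_star \<mu> R xmax xmin \<and>
              tv_dist (measure \<nu>) (measure \<mu>) \<le> R \<and> D_plus l \<mu> R = (\<integral>x. l x \<partial>\<nu>)) \<and>
           D_plus l \<mu> R = signed_integral (nu_star \<mu> R xmax xmin) l \<and>
           D_plus l \<mu> R = R / 2 * ((SUP x. l x) - (INF x. l x)) + (\<integral>x. l x \<partial>\<mu>)))"
proof (intro conjI ballI)
  note \<mu> = assms(1) and bnd = assms(3) and R = assms(5)
  let ?osc = "(SUP x. l x) - (INF x. l x)"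
  have l: "l \<in> borel_measurable borel"
    using assms(2) by (rule borel_measurable_continuous_onI)
  note \<mu>' = borel_probsD(3,2)[OF \<mu>] and \<mu>1 = borel_probsD(4)[OF \<mu>]
  note bound = integral_le_oscillation_tv[OF _ \<mu> l bnd]
  then show "(\<integral>x. l x \<partial>\<nu>) \<le> ?osc * (tv_norm (signed_diff \<nu> \<mu>) / 2) + (\<integral>x. l x \<partial>\<mu>)"
    if "\<nu> \<in> borel_probs" for \<nu> using that .
  fix xmax xmin assume "xmax \<in> argmax_set l" "xmin \<in> argmin_set l"
  then have lx: "l xmax = (SUP x. l x)" "l xmin = (INF x. l x)"
    by (auto simp: argmax_set_def argmin_set_def)
  let ?d = "\<lambda>x. scale_measure (ennreal (R / 2)) (return borel x)"
  let ?\<xi> = "xi_star R xmax xmin" and ?\<nu> = "nu_star \<mu> R xmax xmin"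
  have d: "finite_measure (?d x)" "sets (?d x) = sets borel"
      "(\<integral>y. l y \<partial>?d x) = R / 2 * l x" for x
    using finite_measure_scale_return l R by (simp_all add: integral_scale_measure integral_return)
  note \<xi> = xi_star_eq_diff[OF R, of xmax xmin]
  show fsm: "finite_signed_measure ?\<xi>"
    unfolding \<xi> by (intro finite_signed_measure_diff d)
  show \<xi>0: "?\<xi> UNIV = 0"
    by (simp add: xi_star_def measure_return)
  show "signed_integral ?\<xi> l = R / 2 * ?osc"
    unfolding \<xi> signed_integral_diff[OF d(1,2) d(1,2) l bnd] d(3) lx by (simp add: right_diff_distrib)
  \<comment> \<open>\<open>S\<close> collects the positive terms of \<open>nu_star\<close>, which
    thereby becomes a difference of two finite measures.\<close>
  define S where "S = add_measure \<mu> (?d xmax)"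
  have sets_d: "sets (?d xmax) = sets \<mu>" by (simp only: d(2) \<mu>'(2))
  have S: "finite_measure S" "sets S = sets borel"
    unfolding S_def by (rule finite_measure_add_measure[OF \<mu>'(1) d(1) sets_d])
      (simp only: sets_add_measure \<mu>'(2))
  have measure_S: "measure S A = measure \<mu> A + measure (?d xmax) A" for A
    unfolding S_def by (rule measure_add_measure[OF \<mu>'(1) d(1) sets_d])
  have int_S: "(\<integral>x. l x \<partial>S) = (\<integral>x. l x \<partial>\<mu>) + R / 2 * l xmax"
    unfolding S_def d(3)[symmetric]
    by (intro integral_add_measure integrable_bounded_borel \<mu>' d l bnd sets_d)
  have \<nu>: "?\<nu> = (\<lambda>A. measure S A - measure (?d xmin) A)"
    unfolding nu_star_def \<xi> measure_S by (simp only: add_diff_eq)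
  show si: "signed_integral ?\<nu> l = R / 2 * ?osc + (\<integral>x. l x \<partial>\<mu>)"
    unfolding \<nu> signed_integral_diff[OF S d(1,2) l bnd] int_S d(3) lx by (simp add: right_diff_distrib)
  \<comment> \<open>If the points coincide, supremum and infimum of \<open>l\<close> agree there,
    and the bound is attained whatever the norm is.\<close>
  have "?osc = 0" if "\<not> (xmax \<noteq> xmin \<or> R = 0)"
    using that lx by auto
  then show "signed_integral ?\<nu> l = ?osc * (tv_norm ?\<xi> / 2) + (\<integral>x. l x \<partial>\<mu>)"
    using si tv_norm_xi_star[OF R, of xmax xmin] by (cases "xmax \<noteq> xmin \<or> R = 0") auto
  show \<nu>1: "?\<nu> UNIV = 1"
    using \<xi>0 \<mu>1 by (simp add: nu_star_def)
  show "xmax \<noteq> xmin \<or> R = 0 \<longrightarrow> tv_norm ?\<xi> = R \<and> tv_dist ?\<nu> (measure \<mu>) = R"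
  proof (intro impI conjI)
    assume ne: "xmax \<noteq> xmin \<or> R = 0"
    show tv: "tv_norm ?\<xi> = R" by (rule tv_norm_xi_star[OF R ne])
    \<comment> \<open>Subtracting \<open>\<mu>\<close> from \<open>nu_star\<close> leaves
      \<open>xi_star\<close>; the distance is thus computed without positivity of
      \<open>nu_star\<close>.\<close>
    have "jordan_decomposition (\<lambda>A. ?\<nu> A - measure \<mu> A) (?d xmax) (?d xmin)"
      using jordan_decomposition_xi_star[OF R ne] by (simp add: nu_star_def)
    from tv_dist_eq[OF this] show "tv_dist ?\<nu> (measure \<mu>) = R"
      using tv unfolding tv_norm_eq[OF jordan_decomposition_xi_star[OF R ne]] by simp
  qed
  show "0 \<le> ?\<nu> {xmin} \<longrightarrow> ?\<xi> \<in> signed_tv_ball R \<mu> \<and>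
           (\<forall>A\<in>sets borel. 0 \<le> ?\<nu> A \<and> ?\<nu> A \<le> 1) \<and>
           (\<exists>\<nu>\<in>borel_probs. measure \<nu> = ?\<nu> \<and>
              tv_dist (measure \<nu>) (measure \<mu>) \<le> R \<and> D_plus l \<mu> R = (\<integral>x. l x \<partial>\<nu>)) \<and>
           D_plus l \<mu> R = signed_integral ?\<nu> l \<and>
           D_plus l \<mu> R = R / 2 * ?osc + (\<integral>x. l x \<partial>\<mu>)" (is "_ \<longrightarrow> ?concl")
  proof
    assume atom: "0 \<le> ?\<nu> {xmin}"
    interpret S: finite_measure S by (rule S)
    interpret dmin: finite_measure "?d xmin" by (rule d)
    have dmin: "measure (?d xmin) A = R / 2 * indicator A xmin" if "A \<in> sets borel" for A
      using that R by (simp add: measure_return)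
    \<comment> \<open>The subtracted mass sits at \<open>xmin\<close> alone: sets without that point
      lose nothing, and for the others monotonicity of \<open>S\<close> reduces the claim to
      \<open>{xmin}\<close>.\<close>
    have le: "measure (?d xmin) A \<le> measure S A" if A: "A \<in> sets borel" for A
    proof (cases "xmin \<in> A")
      case True
      have "measure (?d xmin) {xmin} \<le> measure S {xmin}" using atom by (simp add: \<nu>)
      moreover have "measure S {xmin} \<le> measure S A"
        using A True by (intro S.finite_measure_mono) (simp_all add: S(2))
      ultimately show ?thesis using True A by (simp only: dmin) (simp add: dmin)
    qed (simp only: dmin A, simp)
    define \<nu>' where "\<nu>' = diff_measure S (?d xmin)"
    have sets': "sets \<nu>' = sets borel"
      unfolding \<nu>'_def by (simp only: sets_diff_measure S(2))
    have pos: "0 \<le> ?\<nu> A" if "A \<in> sets borel" for A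
      unfolding \<nu> using le[OF that] by linarith
    have em: "emeasure \<nu>' A = ennreal (?\<nu> A)" if A: "A \<in> sets borel" for A
    proof -
      have "emeasure \<nu>' A = emeasure S A - emeasure (?d xmin) A"
        unfolding \<nu>'_def
      proof (rule emeasure_diff_measure[OF S(1) d(1)])
        show "sets S = sets (?d xmin)" by (simp only: S(2) d(2))
        show "A \<in> sets S" using A by (simp only: S(2))
        fix B assume "B \<in> sets S"
        then have "B \<in> sets borel" by (simp only: S(2))
        from le[OF this] show "emeasure (?d xmin) B \<le> emeasure S B"
          unfolding S.emeasure_eq_measure dmin.emeasure_eq_measure by (rule ennreal_leI)
      qed
      then show ?thesis
        unfolding S.emeasure_eq_measure dmin.emeasure_eq_measure \<nu> by (simp only: ennreal_minus measure_nonneg)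
    qed
    have prob: "prob_space \<nu>'"
    proof (rule prob_spaceI)
      have "space \<nu>' = UNIV" using sets_eq_imp_space_eq[OF sets'] by simp
      then show "emeasure \<nu>' (space \<nu>') = 1" using em[of UNIV] \<nu>1 by simp
    qed
    then have \<nu>'P: "\<nu>' \<in> borel_probs" using sets' by (simp add: borel_probs_def)
    have meas: "measure \<nu>' = ?\<nu>"
    proof
      fix A show "measure \<nu>' A = ?\<nu> A"
      proof (cases "A \<in> sets borel")
        case True
        show ?thesis by (rule measure_eq_emeasure_eq_ennreal[OF pos[OF True] em[OF True]])
      next
        \<comment> \<open>The equality of set functions includes non-Borel sets, where every
          \<open>measure\<close> is 0 by default.\<close>
        case False
        then have "A \<notin> sets \<nu>'" "A \<notin> sets S" "A \<notin> sets (?d xmin)"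
          by (simp_all only: sets' S(2) d(2) not_False_eq_True)
        then show ?thesis unfolding \<nu> by (simp only: measure_notin_sets diff_self not_False_eq_True)
      qed
    qed
    have sd: "?\<xi> = signed_diff \<nu>' \<mu>" unfolding signed_diff_def meas nu_star_def by simp
    \<comment> \<open>Only an inequality, since the norm drops to 0 when the two points
      coincide.\<close>
    have tv: "tv_norm ?\<xi> \<le> R"
      using tv_norm_xi_star[OF R, of xmax xmin] tv_norm_xi_star[of 0 xmax xmax] xi_star_refl[of R xmax] R
      by (cases "xmax = xmin") auto
    have ball: "?\<xi> \<in> signed_tv_ball R \<mu>"
      unfolding signed_tv_ball_def using fsm \<xi>0 \<nu>'P sd tv by blast
    have dist: "tv_dist (measure \<nu>') (measure \<mu>) \<le> R"
      using tv sd tv_dist_eq_tv_norm[OF \<nu>'P \<mu>] by simp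
    have int: "(\<integral>x. l x \<partial>\<nu>') = R / 2 * ?osc + (\<integral>x. l x \<partial>\<mu>)"
    proof -
      \<comment> \<open>Subtracting the null measure presents \<open>\<nu>'\<close> as a difference,
        so its ordinary integral is the signed integral already computed.\<close>
      let ?z = "null_measure borel :: 'a measure"
      have z: "finite_measure ?z" "sets ?z = sets borel"
        by (rule finite_measureI) simp_all
      have "?\<nu> = (\<lambda>A. measure \<nu>' A - measure ?z A)"
        unfolding meas by simp
      then have "signed_integral ?\<nu> l = (\<integral>x. l x \<partial>\<nu>') - (\<integral>x. l x \<partial>?z)"
        using signed_integral_diff[OF borel_probsD(3,2)[OF \<nu>'P] z l bnd] by (simp only:)
      then show ?thesis using si by simp
    qed
    have "D_plus l \<mu> R = R / 2 * ?osc + (\<integral>x. l x \<partial>\<mu>)"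
      unfolding D_plus_def
    proof (rule cSup_eq_maximum)
      show "R / 2 * ?osc + (\<integral>x. l x \<partial>\<mu>) \<in>
          {\<integral>x. l x \<partial>\<nu> |\<nu>. \<nu> \<in> borel_probs \<and> tv_dist (measure \<nu>) (measure \<mu>) \<le> R}"
        using int \<nu>'P dist by force
      fix v assume "v \<in> {\<integral>x. l x \<partial>\<nu> |\<nu>. \<nu> \<in> borel_probs \<and> tv_dist (measure \<nu>) (measure \<mu>) \<le> R}"
      then obtain \<nu>'' where v: "v = (\<integral>x. l x \<partial>\<nu>'')" and \<nu>'': "\<nu>'' \<in> borel_probs"
        and "tv_dist (measure \<nu>'') (measure \<mu>) \<le> R" by auto
      then have "tv_norm (signed_diff \<nu>'' \<mu>) / 2 \<le> R / 2"
        using tv_dist_eq_tv_norm[OF \<nu>'' \<mu>] by simp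
      \<comment> \<open>Nonnegative oscillation makes the general bound increase with the norm, so
        the constraint may be inserted into it.\<close>
      moreover have "0 \<le> ?osc"
        using bnd lx(2) cSUP_upper[of xmin UNIV l] by (simp add: bounded_imp_bdd_above)
      ultimately have "?osc * (tv_norm (signed_diff \<nu>'' \<mu>) / 2) \<le> ?osc * (R / 2)"
        by (rule mult_left_mono)
      then show "v \<le> R / 2 * ?osc + (\<integral>x. l x \<partial>\<mu>)"
        using bound[OF \<nu>''] unfolding v by (simp add: mult.commute)
    qed
    \<comment> \<open>The upper bound comes from the probability measure \<open>\<nu>'\<close> that
      realizes the set function.\<close>
    moreover have "?\<nu> A \<le> 1" for A
      using prob_space.prob_le_1[OF prob, of A] by (simp add: meas)
    ultimately show ?concl
      by (intro conjI ballI bexI[OF _ \<nu>'P]) (simp_all only: ball measure_nonneg meas[symmetric] dist int si[folded meas])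
  qed
qed

end
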